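(* Let $k$ be odd and $m\ge2$ an integer. Then there exists a latin square of order $n=2km$ that has a $k$-plex but has no $k'$-plex for any odd $k'<k$.
   Context: A latin square of order $n$ is viewed as a set of entries (row, column, symbol). A $k$-plex is a set of $kn$ entries containing exactly $k$ entries from each row and each column, with each symbol occurring in exactly $k$ of them. *)

theory Defs
  imports Main
begin

text \<open>
  A latin square of order \<open>n\<close> is given by its set of entries (row, column, symbol);
  rows, columns and symbols are all indexed by \<open>{..<n}\<close>.
\<close>

type_synonym entry = "nat \<times> nat \<times> nat"

definition row :: "entry \<Rightarrow> nat" where
  "row e = fst e"

definition col :: "entry \<Rightarrow> nat" where
  "col e = fst (snd e)"

definition symb :: "entry \<Rightarrow> nat" where
  "symb e = snd (snd e)"

definition latin_square :: "nat \<Rightarrow> entry set \<Rightarrow> bool" where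
  "latin_square n L \<longleftrightarrow>
     L \<subseteq> {..<n} \<times> {..<n} \<times> {..<n} \<and>
     (\<forall>r<n. \<forall>c<n. \<exists>!s. (r, c, s) \<in> L) \<and>
     (\<forall>r<n. \<forall>s<n. \<exists>!c. (r, c, s) \<in> L) \<and>
     (\<forall>c<n. \<forall>s<n. \<exists>!r. (r, c, s) \<in> L)"

definition plex :: "nat \<Rightarrow> nat \<Rightarrow> entry set \<Rightarrow> entry set \<Rightarrow> bool" where
  "plex k n L P \<longleftrightarrow>
     P \<subseteq> L \<and> card P = k * n \<and>
     (\<forall>r<n. card {e \<in> P. row e = r} = k) \<and>
     (\<forall>c<n. card {e \<in> P. col e = c} = k) \<and>
     (\<forall>s<n. card {e \<in> P. symb e = s} = k)"

end

theory Submission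
  imports Defs
begin

text \<open>
  Take the addition table of the integers modulo \<open>n = 2km\<close> and interchange rows \<open>0\<close> and \<open>m\<close> in the
  columns divisible by \<open>m\<close>. The defect \<open>symbol - row - column\<close> is then \<open>m\<close> or \<open>-m\<close> on the
  interchanged cells of row \<open>0\<close> or \<open>m\<close> and \<open>0\<close> elsewhere (modulo \<open>n\<close>), whereas for odd \<open>k'\<close> the
  defects of a \<open>k'\<close>-plex sum to \<open>n/2 = km\<close>; since each of the two rows contributes at most \<open>k'm\<close>
  in absolute value, \<open>k' \<ge> k\<close>.

  For a \<open>k\<close>-plex, let row \<open>r\<close> use the \<open>k\<close> columns in one residue class \<open>x r\<close> modulo \<open>2m\<close>. The symbols
  then also form a residue class \<open>y r\<close>, equal to \<open>x r + r\<close> except that \<open>y 0 = m\<close>, and it suffices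
  that \<open>x\<close> and \<open>y\<close> take each value \<open>k\<close> times. The rows below \<open>2m\<close> come from a near transversal of
  the addition table modulo \<open>2m\<close>, the remaining ones from 2-plexes of that table.
\<close>

section \<open>Counting and cancellation on initial segments of the naturals\<close>

lemma card_less_add:
  fixes a b :: nat
  shows "card {r. r < a + b \<and> Q r} = card {r. r < a \<and> Q r} + card {j. j < b \<and> Q (a + j)}"
proof -
  have "{r. r < a + b \<and> Q r} = {r. r < a \<and> Q r} \<union> (+) a ` {j. j < b \<and> Q (a + j)}"
    by (auto simp: image_iff) (metis add_diff_inverse_nat nat_add_left_cancel_less)
  moreover have "card ((+) a ` {j. j < b \<and> Q (a + j)}) = card {j. j < b \<and> Q (a + j)}"
    by (rule card_image) auto
  moreover have "{r. r < a \<and> Q r} \<inter> (+) a ` {j. j < b \<and> Q (a + j)} = {}"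
    by auto
  ultimately show ?thesis
    by (simp add: card_Un_disjoint)
qed

lemma inj_on_lessThan_ex1:
  fixes f :: "nat \<Rightarrow> nat"
  assumes "inj_on f {..<n}" and "\<And>i. i < n \<Longrightarrow> f i < n" and "v < n"
  shows "\<exists>!i. i < n \<and> f i = v"
proof -
  have "f ` {..<n} = {..<n}"
    using assms(1,2) by (intro endo_inj_surj) auto
  then obtain i where "i < n" "f i = v"
    using assms(3) by (metis imageE lessThan_iff)
  then show ?thesis
    using assms(1) by (auto simp: inj_on_def)
qed

lemma card_inj_on_lessThan_eq:
  fixes f :: "nat \<Rightarrow> nat"
  assumes "inj_on f {..<n}" and "\<And>i. i < n \<Longrightarrow> f i < n" and "v < n"
  shows "card {i. i < n \<and> f i = v} = 1"
proof -
  obtain j where "i < n \<and> f i = v \<longleftrightarrow> i = j" for i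
    using inj_on_lessThan_ex1[OF assms] by blast
  then show ?thesis
    by simp
qed

lemma mod_eq_if_less_double:
  fixes a d :: nat
  assumes "a < 2 * d"
  shows "a mod d = (if a < d then a else a - d)"
  using assms by (simp add: le_mod_geq)

lemma add_mod_cancel_nat:
  fixes a b c n :: nat
  assumes "(a + c) mod n = (b + c) mod n"
  shows "a mod n = b mod n"
proof -
  have "(int a + int c - int c) mod int n = (int b + int c - int c) mod int n"
    using assms by (metis mod_diff_cong of_nat_add of_nat_mod)
  then show ?thesis
    by (simp add: zmod_int[symmetric])
qed

lemma card_mod_eq:
  fixes d v k :: nat
  assumes "v < d"
  shows "card {c. c < d * k \<and> c mod d = v} = k"
proof (induction k)
  case (Suc k)
  have "{j. j < d \<and> (d * k + j) mod d = v} = {v}"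
    using assms by auto
  then show ?case
    using Suc card_less_add[of "d * k" d "\<lambda>c. c mod d = v"] by (simp add: add.commute)
qed simp

section \<open>The switched square\<close>

definition row_swap :: "nat \<Rightarrow> nat \<Rightarrow> nat" where
  "row_swap m r = (if r = 0 then m else if r = m then 0 else r)"

text \<open>The interchange acts on the row index, so that every column is a column of the addition
  table read through a permutation of the rows.\<close>

definition cell :: "nat \<Rightarrow> nat \<Rightarrow> nat \<Rightarrow> nat \<Rightarrow> nat" where
  "cell m n r c = ((if m dvd c then row_swap m r else r) + c) mod n"

definition switched_square :: "nat \<Rightarrow> nat \<Rightarrow> entry set" where
  "switched_square m n = {(r, c, s). r < n \<and> c < n \<and> s = cell m n r c}"

lemma cell_col_inj:
  assumes "m < n"
  shows "inj_on (\<lambda>r. cell m n r c) {..<n}"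
proof (rule inj_onI)
  fix r r' assume "r \<in> {..<n}" "r' \<in> {..<n}" "cell m n r c = cell m n r' c"
  then have "(if m dvd c then row_swap m r else r) = (if m dvd c then row_swap m r' else r')"
    (is "?a = ?a'")
  proof -
    have "?a < n" "?a' < n"
      using \<open>r \<in> {..<n}\<close> \<open>r' \<in> {..<n}\<close> assms by (auto simp: row_swap_def)
    then show ?thesis
      using \<open>cell m n r c = cell m n r' c\<close> add_mod_cancel_nat[of ?a c n ?a']
      unfolding cell_def by simp
  qed
  then show "r = r'"
    by (auto simp: row_swap_def split: if_splits)
qed

text \<open>Only rows \<open>0\<close> and \<open>m\<close> need care. As \<open>m\<close> divides
  \<open>n\<close>, a symbol there is a multiple of \<open>m\<close> exactly when its column is, so
  switched and unswitched cells cannot share a symbol; within each kind the row is a cyclic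
  shift.\<close>

lemma cell_row_inj:
  assumes "m dvd n"
  shows "inj_on (\<lambda>c. cell m n r c) {..<n}"
proof (rule inj_onI)
  fix c c' assume c: "c \<in> {..<n}" "c' \<in> {..<n}" and eq: "cell m n r c = cell m n r c'"
  show "c = c'"
  proof (cases "r = 0 \<or> r = m")
    case True
    then have dvd: "m dvd cell m n r d \<longleftrightarrow> m dvd d" for d
      using assms by (auto simp: cell_def row_swap_def dvd_mod_iff)
    then have "m dvd c \<longleftrightarrow> m dvd c'"
      using eq by metis
    then show ?thesis
      using c eq by (auto simp: cell_def add.commute[of _ c] add.commute[of _ c']
            split: if_splits dest!: add_mod_cancel_nat)
  next
    case False
    then have "(c + r) mod n = (c' + r) mod n"
      using eq by (simp add: cell_def row_swap_def add.commute split: if_splits)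
    then show ?thesis
      using c add_mod_cancel_nat[of c r n c'] by simp
  qed
qed

lemma latin_switched_square:
  assumes "m dvd n" and "m < n"
  shows "latin_square n (switched_square m n)"
proof -
  have lt: "cell m n r c < n" for r c
    using assms by (simp add: cell_def)
  have "\<exists>!c. c < n \<and> cell m n r c = s" if "s < n" for r s
    using inj_on_lessThan_ex1[OF cell_row_inj[OF assms(1)] lt that] .
  moreover have "\<exists>!r. r < n \<and> cell m n r c = s" if "s < n" for c s
    using inj_on_lessThan_ex1[OF cell_col_inj[OF assms(2)] lt that] .
  ultimately show ?thesis
    unfolding latin_square_def switched_square_def using lt by (auto; metis)
qed

section \<open>The defect of a plex\<close>

text \<open>Used with \<open>g\<close> as \<open>row\<close>, \<open>col\<close> and
  \<open>symb\<close>: the three coordinate sums of a plex coincide.\<close>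

lemma plex_sum:
  fixes g :: "entry \<Rightarrow> nat"
  assumes "finite P" and "g ` P \<subseteq> {..<n}" and "\<forall>i<n. card {e \<in> P. g e = i} = k"
  shows "(\<Sum>e\<in>P. int (g e)) = int k * (\<Sum>i<n. int i)"
proof -
  have "(\<Sum>e\<in>P. int (g e)) = (\<Sum>i<n. \<Sum>e\<in>{e \<in> P. g e = i}. int (g e))"
    using sum.group[OF assms(1) finite_lessThan assms(2), of "\<lambda>e. int (g e)"] by metis
  also have "\<dots> = (\<Sum>i<n. int k * int i)"
    using assms(3) by (intro sum.cong) auto
  finally show ?thesis
    by (simp add: sum_distrib_left)
qed

text \<open>Stated over the integers because the defect is negative on the switched cells of row
  \<open>m\<close>.\<close>

lemma defect_cell:
  assumes "r < n" and "c < n"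
  shows "int n dvd int (cell m n r c) - int r - int c
           - (if m dvd c then (if r = 0 then int m else if r = m then - int m else 0) else 0)"
  by (auto simp: cell_def row_swap_def zmod_int mod_eq_dvd_iff[symmetric] mod_simps algebra_simps)

text \<open>The three equal coordinate sums make the total defect \<open>-k' * T\<close>, while the
  switched cells supply \<open>m * (card A - card B)\<close>; these must agree modulo
  \<open>n\<close>.\<close>

lemma no_small_odd_plex:
  assumes "odd k" and "m > 0" and n: "n = 2 * k * m" and "odd k'" and "k' < k"
  shows "\<not> plex k' n (switched_square m n) P"
proof
  assume plex: "plex k' n (switched_square m n) P"
  have sub: "P \<subseteq> switched_square m n"
    using plex by (simp add: plex_def)
  have "switched_square m n \<subseteq> {..<n} \<times> {..<n} \<times> {..<n}"
    by (auto simp: switched_square_def cell_def)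
  with sub have P: "P \<subseteq> {..<n} \<times> {..<n} \<times> {..<n}"
    by blast
  then have fin: "finite P"
    by (rule finite_subset) simp
  define T where "T = (\<Sum>i<n. int i)"
  define A where "A = {e \<in> P. row e = 0 \<and> m dvd col e}"
  define B where "B = {e \<in> P. row e = m \<and> m dvd col e}"
  define \<delta> where "\<delta> e = (if e \<in> A then int m else 0) - (if e \<in> B then int m else 0)" for e
  have sums: "(\<Sum>e\<in>P. int (row e)) = int k' * T" "(\<Sum>e\<in>P. int (col e)) = int k' * T"
      "(\<Sum>e\<in>P. int (symb e)) = int k' * T"
    unfolding T_def using plex P fin
    by (auto intro!: plex_sum simp: plex_def row_def col_def symb_def)
  have "int n dvd (\<Sum>e\<in>P. int (symb e) - int (row e) - int (col e) - \<delta> e)"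
  proof (rule dvd_sum)
    fix e assume e: "e \<in> P"
    obtain r c s where rcs: "e = (r, c, s)"
      by (cases e)
    then have "r < n" "c < n" "s = cell m n r c"
      using e sub by (auto simp: switched_square_def)
    then show "int n dvd int (symb e) - int (row e) - int (col e) - \<delta> e"
      using defect_cell[of r n c m] e rcs \<open>m > 0\<close>
      by (auto simp: \<delta>_def A_def B_def row_def col_def symb_def split: if_splits)
  qed
  moreover have "(\<Sum>e\<in>P. \<delta> e) = int m * (int (card A) - int (card B))"
  proof -
    have "P \<inter> A = A" "P \<inter> B = B"
      by (auto simp: A_def B_def)
    then show ?thesis
      using fin by (simp add: \<delta>_def sum_subtractf sum.inter_restrict[symmetric] algebra_simps)
  qed
  ultimately have "int n dvd - (int k' * T + int m * (int (card A) - int (card B)))"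
    using sums by (simp add: sum_subtractf)
  then have "int n dvd int k' * T + int m * (int (card A) - int (card B))"
    by (simp only: dvd_minus_iff)
  moreover have T: "T = int k * int m * (int n - 1)"
  proof -
    have "2 * (\<Sum>i<j. int i) = int j * (int j - 1)" for j
      by (induction j) (simp_all add: algebra_simps)
    from this[of n] have "2 * T = 2 * (int k * int m * (int n - 1))"
      unfolding T_def by (simp add: n)
    then show ?thesis
      by simp
  qed
  \<comment> \<open>Both \<open>n\<close> and \<open>T\<close> carry a factor \<open>m\<close>,
    which is now cancelled.\<close>
  ultimately have "int m * (2 * int k) dvd
      int m * (int k' * int k * (int n - 1) + (int (card A) - int (card B)))"
    by (simp add: n algebra_simps)
  then have dvd: "2 * int k dvd int k' * int k * (int n - 1) + (int (card A) - int (card B))"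
    using \<open>m > 0\<close> by simp
  \<comment> \<open>Modulo \<open>k\<close> the first summand vanishes, so \<open>k\<close> divides
    \<open>card A - card B\<close>. Both cardinalities are at most \<open>k' < k\<close>, which
    forces them to be equal.\<close>
  then have "int k dvd int k' * int k * (int n - 1) + (int (card A) - int (card B))"
    by (rule dvd_mult_right)
  then have "int k dvd int (card A) - int (card B)"
    by (simp add: dvd_add_right_iff)
  moreover have "card A \<le> k'" "card B \<le> k'"
  proof -
    have "0 < n" "m < n"
      using n \<open>m > 0\<close> \<open>odd k\<close> by (auto elim: oddE)
    then have "card {e \<in> P. row e = 0} = k'" "card {e \<in> P. row e = m} = k'"
      using plex by (auto simp: plex_def)
    moreover have "card A \<le> card {e \<in> P. row e = 0}" "card B \<le> card {e \<in> P. row e = m}"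
      using fin by (auto simp: A_def B_def intro!: card_mono)
    ultimately show "card A \<le> k'" "card B \<le> k'"
      by simp_all
  qed
  ultimately have "int (card A) - int (card B) = 0"
    using \<open>k' < k\<close> dvd_imp_le_int[of "int (card A) - int (card B)" "int k"] by linarith
  \<comment> \<open>Only parity remains: \<open>2\<close> would divide a product of two odd
    numbers.\<close>
  then have "int k * 2 dvd int k * (int k' * (int n - 1))"
    using dvd by (simp add: algebra_simps)
  then have "2 dvd int k' * (int n - 1)"
    using \<open>k' < k\<close> by (simp only: dvd_mult_cancel_left) simp
  then show False
    using \<open>odd k'\<close> n by simp
qed

section \<open>The plex\<close>

text \<open>With row \<open>0\<close> set aside, the sums \<open>plex_col m r + r\<close> for
  \<open>r < 2 * m\<close> run modulo \<open>2 * m\<close> through all residues except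
  \<open>m\<close>. Later rows come in pairs of blocks, whose diagonals \<open>x = r\<close> and
  \<open>x = r + 1\<close> modulo \<open>2 * m\<close> form a 2-plex.\<close>

definition plex_col :: "nat \<Rightarrow> nat \<Rightarrow> nat" where
  "plex_col m r =
     (if r = 0 then 0 else if r \<le> m then r + m - 1 else if r < 2 * m then r - m
      else let j = (r - 2 * m) mod (4 * m) in if j < 2 * m then j else (j + 1) mod (2 * m))"

text \<open>Row \<open>0\<close> is exceptional because its columns in the plex, the multiples of
  \<open>2 * m\<close>, are all switched. This supplies the residue \<open>m\<close> missing from
  the near transversal.\<close>

definition plex_symb :: "nat \<Rightarrow> nat \<Rightarrow> nat" where
  "plex_symb m r = (if r = 0 then m else (plex_col m r + r) mod (2 * m))"

definition switched_plex :: "nat \<Rightarrow> nat \<Rightarrow> entry set" where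
  "switched_plex m n =
     {(r, c, s). r < n \<and> c < n \<and> s = cell m n r c \<and> c mod (2 * m) = plex_col m r}"

lemma plex_col_less: "m > 0 \<Longrightarrow> plex_col m r < 2 * m"
  by (auto simp: plex_col_def Let_def)

lemma plex_symb_less: "m > 0 \<Longrightarrow> plex_symb m r < 2 * m"
  by (simp add: plex_symb_def)

text \<open>Blocks of \<open>2 * m\<close> rows are numbered from \<open>0\<close>, block
  \<open>0\<close> being the near transversal. Odd and even later blocks are the two halves of a
  period \<open>4 * m\<close>.\<close>

lemma plex_col_late:
  assumes "i < 2 * m"
  shows "plex_col m (2 * m * (2 * p + 1) + i) = i"
    and "plex_col m (2 * m * (2 * p + 2) + i) = (i + 1) mod (2 * m)"
proof -
  have "(2 * m * (2 * p + 1) + i - 2 * m) mod (4 * m) = (i + 4 * m * p) mod (4 * m)"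
    by (simp add: algebra_simps)
  also have "\<dots> = i"
    using assms by (simp only: mod_mult_self2) simp
  finally show "plex_col m (2 * m * (2 * p + 1) + i) = i"
    using assms by (simp add: plex_col_def Let_def)
  have "(2 * m * (2 * p + 2) + i - 2 * m) mod (4 * m) = (2 * m + i + 4 * m * p) mod (4 * m)"
    by (simp add: algebra_simps)
  also have "\<dots> = 2 * m + i"
    using assms by (simp only: mod_mult_self2) simp
  finally show "plex_col m (2 * m * (2 * p + 2) + i) = (i + 1) mod (2 * m)"
    using assms by (simp add: plex_col_def Let_def) (metis add_Suc_right mod_add_self1)
qed

lemma plex_symb_late:
  assumes "i < 2 * m"
  shows "plex_symb m (2 * m * (2 * p + 1) + i) = (2 * i) mod (2 * m)"
    and "plex_symb m (2 * m * (2 * p + 2) + i) = (2 * i + 1) mod (2 * m)"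
proof -
  have "(i + (2 * m * (2 * p + 1) + i)) mod (2 * m) = (2 * i + 2 * m * (2 * p + 1)) mod (2 * m)"
    by (simp add: algebra_simps)
  then show "plex_symb m (2 * m * (2 * p + 1) + i) = (2 * i) mod (2 * m)"
    using assms unfolding plex_symb_def plex_col_late[OF assms] by (simp only: mod_mult_self2) simp
  have "((i + 1) mod (2 * m) + (2 * m * (2 * p + 2) + i)) mod (2 * m)
      = ((i + 1) + (2 * m * (2 * p + 2) + i)) mod (2 * m)"
    by (rule mod_add_left_eq)
  also have "\<dots> = (2 * i + 1 + 2 * m * (2 * p + 2)) mod (2 * m)"
    by (simp add: algebra_simps)
  finally show "plex_symb m (2 * m * (2 * p + 2) + i) = (2 * i + 1) mod (2 * m)"
    using assms unfolding plex_symb_def plex_col_late[OF assms] by (simp only: mod_mult_self2) simp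
qed

text \<open>An odd number of blocks is one initial block followed by pairs. Only the total over a
  pair is prescribed, since its two blocks may meet \<open>v\<close> unequally.\<close>

lemma card_fibre_by_blocks:
  fixes F :: "nat \<Rightarrow> nat"
  assumes "card {i. i < d \<and> F i = v} = 1"
    and "\<And>p. card {i. i < d \<and> F (d * (2 * p + 1) + i) = v}
             + card {i. i < d \<and> F (d * (2 * p + 2) + i) = v} = 2"
  shows "card {r. r < d * (2 * p + 1) \<and> F r = v} = 2 * p + 1"
proof (induction p)
  case 0
  then show ?case
    using assms(1) by simp
next
  case (Suc p)
  have eq: "d * (2 * Suc p + 1) = d * (2 * p + 1) + d + d" "d * (2 * p + 1) + d = d * (2 * p + 2)"
    by (simp_all add: algebra_simps)
  show ?case
    unfolding eq(1) card_less_add Suc using assms(2)[of p] unfolding eq(2) by simp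
qed

lemma card_plex_col:
  assumes "v < 2 * m"
  shows "card {r. r < 2 * m * (2 * p + 1) \<and> plex_col m r = v} = 2 * p + 1"
proof (rule card_fibre_by_blocks)
  have m: "m > 0"
    using assms by simp
  have "inj_on (plex_col m) {..<2 * m}"
    by (rule inj_onI) (auto simp: plex_col_def split: if_splits)
  then show "card {i. i < 2 * m \<and> plex_col m i = v} = 1"
    using assms plex_col_less[OF m] by (intro card_inj_on_lessThan_eq) auto
  fix p
  have "{i. i < 2 * m \<and> plex_col m (2 * m * (2 * p + 1) + i) = v} = {v}"
    using assms plex_col_late(1) by auto
  moreover have "card {i. i < 2 * m \<and> (i + 1) mod (2 * m) = v} = 1"
    using assms
    by (intro card_inj_on_lessThan_eq)
      (auto intro!: inj_onI dest!: add_mod_cancel_nat simp del: One_nat_def add_Suc_right)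
  moreover have "{i. i < 2 * m \<and> plex_col m (2 * m * (2 * p + 2) + i) = v}
      = {i. i < 2 * m \<and> (i + 1) mod (2 * m) = v}"
    using plex_col_late(2) by auto
  ultimately show "card {i. i < 2 * m \<and> plex_col m (2 * m * (2 * p + 1) + i) = v}
      + card {i. i < 2 * m \<and> plex_col m (2 * m * (2 * p + 2) + i) = v} = 2"
    by simp
qed

lemma card_plex_symb:
  assumes "v < 2 * m"
  shows "card {r. r < 2 * m * (2 * p + 1) \<and> plex_symb m r = v} = 2 * p + 1"
proof (rule card_fibre_by_blocks)
  have m: "m > 0"
    using assms by simp
  \<comment> \<open>For \<open>0 < r\<close>, the two disjuncts of each range of rows correspond to
    the sum staying below \<open>2 * m\<close> or wrapping around once.\<close>
  have early: "r = 0 \<and> plex_symb m r = m \<or>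
      0 < r \<and> r \<le> m \<and> plex_symb m r + 1 = 2 * r + m \<or>
      0 < r \<and> r \<le> m \<and> plex_symb m r + m + 1 = 2 * r \<or>
      m < r \<and> plex_symb m r + m = 2 * r \<or>
      m < r \<and> plex_symb m r + 3 * m = 2 * r" if "r < 2 * m" for r
    using that m by (auto simp: plex_symb_def plex_col_def mod_eq_if_less_double)
  \<comment> \<open>Parity separates the symbols of rows \<open>1\<close> to \<open>m\<close> from
    the others, so a coincidence could only occur within one of these two groups.\<close>
  have parity: "even (plex_symb m r + m) \<longleftrightarrow> r = 0 \<or> m < r" if "r < 2 * m" for r
    using early[OF that] by (elim disjE conjE; presburger)
  have "inj_on (plex_symb m) {..<2 * m}"
  proof (rule inj_onI)
    fix r r' assume "r \<in> {..<2 * m}" "r' \<in> {..<2 * m}" "plex_symb m r = plex_symb m r'"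
    then obtain y where lt: "r < 2 * m" "r' < 2 * m"
      and y: "plex_symb m r = y" "plex_symb m r' = y"
      by simp
    show "r = r'"
      using early[OF lt(1)] early[OF lt(2)] lt parity[OF lt(1)] parity[OF lt(2)] unfolding y
      by (elim disjE conjE; simp?; linarith?)
  qed
  then show "card {i. i < 2 * m \<and> plex_symb m i = v} = 1"
    using assms m by (intro card_inj_on_lessThan_eq) (auto simp: plex_symb_less)
  fix p
  \<comment> \<open>Doubling is two-to-one modulo \<open>2 * m\<close>: one block of a pair takes
    every even symbol class twice, the other every odd class twice.\<close>
  have two: "card {i. i < 2 * m \<and> (2 * i + b) mod (2 * m) = v} = (if v mod 2 = b then 2 else 0)"
    if "b < 2" for b
  proof -
    have "{i. i < 2 * m \<and> (2 * i + b) mod (2 * m) = v}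
        = (if v mod 2 = b then {v div 2, v div 2 + m} else {})"
    proof -
      have "(i < 2 * m \<and> (2 * i + b) mod (2 * m) = v) \<longleftrightarrow>
          v mod 2 = b \<and> (i = v div 2 \<or> i = v div 2 + m)" for i
      proof -
        have "(i < 2 * m \<and> (2 * i + b) mod (2 * m) = v) \<longleftrightarrow>
            i < 2 * m \<and> (2 * i + b = v \<or> 2 * i + b = v + 2 * m)"
          using assms that by (auto simp: mod_eq_if_less_double)
        also have "\<dots> \<longleftrightarrow> v mod 2 = b \<and> (i = v div 2 \<or> i = v div 2 + m)"
        proof (cases "v mod 2 = b")
          case True
          then have "v = 2 * (v div 2) + b"
            by (metis mult_div_mod_eq)
          then show ?thesis
            using True assms by linarith
        next
          case False
          have "(2 * i + b) mod 2 = b" "(v + 2 * m) mod 2 = v mod 2"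
            using that by simp_all
          with False show ?thesis
            by metis
        qed
        finally show ?thesis .
      qed
      then show ?thesis
        by auto
    qed
    then show ?thesis
      using m by simp
  qed
  have "{i. i < 2 * m \<and> plex_symb m (2 * m * (2 * p + 1) + i) = v}
      = {i. i < 2 * m \<and> (2 * i + 0) mod (2 * m) = v}"
    using plex_symb_late(1) by auto
  moreover have "{i. i < 2 * m \<and> plex_symb m (2 * m * (2 * p + 2) + i) = v}
      = {i. i < 2 * m \<and> (2 * i + 1) mod (2 * m) = v}"
    using plex_symb_late(2) by auto
  ultimately show "card {i. i < 2 * m \<and> plex_symb m (2 * m * (2 * p + 1) + i) = v}
      + card {i. i < 2 * m \<and> plex_symb m (2 * m * (2 * p + 2) + i) = v} = 2"
    using two[of 0] two[of 1] by (simp only:) (auto split: if_splits; presburger)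
qed

text \<open>Having an equivalence allows the plex to be counted from the symbol side as well. The
  switch alters only row \<open>0\<close> of the plex: in row \<open>m\<close> its columns are
  \<open>2 * m - 1\<close> modulo \<open>2 * m\<close>, never multiples of \<open>m\<close> when
  \<open>m \<ge> 2\<close>.\<close>

lemma plex_col_iff_plex_symb:
  assumes "m \<ge> 2" and "2 * m dvd n"
  shows "c mod (2 * m) = plex_col m r \<longleftrightarrow> cell m n r c mod (2 * m) = plex_symb m r"
proof -
  have cell: "cell m n r c mod (2 * m) = ((if m dvd c then row_swap m r else r) + c) mod (2 * m)"
    using assms(2) by (simp add: cell_def mod_mod_cancel)
  have dvd: "m dvd c \<longleftrightarrow> m dvd c mod (2 * m)"
    by (simp add: dvd_mod_iff)
  show ?thesis
  proof (cases "r = 0 \<or> r = m \<and> m dvd c")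
    case False
    then have "cell m n r c mod (2 * m) = (c + r) mod (2 * m)"
      unfolding cell by (auto simp: row_swap_def add.commute)
    moreover have "(c + r) mod (2 * m) = (plex_col m r + r) mod (2 * m) \<longleftrightarrow>
        c mod (2 * m) = plex_col m r"
    proof
      have "plex_col m r mod (2 * m) = plex_col m r"
        using plex_col_less[of m r] assms(1) by simp
      then show "c mod (2 * m) = plex_col m r"
        if "(c + r) mod (2 * m) = (plex_col m r + r) mod (2 * m)"
        using add_mod_cancel_nat[OF that] by simp
      show "(c + r) mod (2 * m) = (plex_col m r + r) mod (2 * m)"
        if "c mod (2 * m) = plex_col m r"
        using that by (metis mod_add_left_eq)
    qed
    ultimately show ?thesis
      using False by (auto simp: plex_symb_def)
  next
    case True
    show ?thesis
    proof (cases "m dvd c")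
      case mc: True
      then obtain q where q: "c mod (2 * m) = m * q"
        using dvd by (auto elim: dvdE)
      then have "m * q < m * 2"
        using assms(1) by (metis mod_less_divisor mult.commute mult_pos_pos zero_less_numeral less_le_trans)
      then have "q = 0 \<or> q = 1"
        by auto
      then have c: "c mod (2 * m) = 0 \<or> c mod (2 * m) = m"
        using q by auto
      have "(m + c) mod (2 * m) = (m + c mod (2 * m)) mod (2 * m)"
        by (simp add: mod_add_right_eq)
      then have "(m + c) mod (2 * m) = (if c mod (2 * m) = 0 then m else 0)"
        using c assms(1) by (auto simp flip: mult_2)
      \<comment> \<open>Switched cells of row \<open>m\<close> have column and symbol classes
        \<open>0\<close> or \<open>m\<close>. As \<open>m \<ge> 2\<close>, these differ from
        \<open>2 * m - 1\<close> and \<open>m - 1\<close>, so both sides of the equivalence fail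
        there.\<close>
      moreover have "plex_symb m m = m - 1"
        using assms(1) by (auto simp: plex_symb_def plex_col_def mod_eq_if_less_double)
      ultimately show ?thesis
        unfolding cell using mc True c assms(1)
        by (auto simp: row_swap_def plex_col_def plex_symb_def)
    next
      case False
      then show ?thesis
        unfolding cell using True dvd by (auto simp: plex_col_def plex_symb_def)
    qed
  qed
qed

lemma plex_switched_plex:
  assumes "odd k" and "m \<ge> 2" and n: "n = 2 * k * m"
  shows "plex k n (switched_square m n) (switched_plex m n)"
proof -
  let ?P = "switched_plex m n"
  obtain p where k: "k = 2 * p + 1"
    using \<open>odd k\<close> by (rule oddE)
  have n': "n = 2 * m * k"
    by (simp add: n)
  have mn: "m dvd n" "2 * m dvd n" "m < n"
    using assms(2) by (auto simp: n k)
  have sub: "?P \<subseteq> switched_square m n"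
    by (auto simp: switched_plex_def switched_square_def)
  have latin: "latin_square n (switched_square m n)"
    using mn by (intro latin_switched_square)
  then have "?P \<subseteq> {..<n} \<times> {..<n} \<times> {..<n}"
    using sub by (auto simp: latin_square_def)
  then have fin: "finite ?P"
    by (rule finite_subset) simp
  have rows: "card {e \<in> ?P. row e = r} = k" if "r < n" for r
  proof -
    have "{e \<in> ?P. row e = r}
        = (\<lambda>c. (r, c, cell m n r c)) ` {c. c < 2 * m * k \<and> c mod (2 * m) = plex_col m r}"
      using that by (auto simp: switched_plex_def row_def n' image_iff)
    moreover have "inj (\<lambda>c. (r, c, cell m n r c))"
      by (rule injI) simp
    ultimately show ?thesis
      using card_mod_eq[of "plex_col m r" "2 * m" k] plex_col_less[of m r] assms(2)
      by (simp add: card_image inj_on_subset)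
  qed
  have cols: "card {e \<in> ?P. col e = c} = k" if "c < n" for c
  proof -
    have "{e \<in> ?P. col e = c}
        = (\<lambda>r. (r, c, cell m n r c)) ` {r. r < 2 * m * (2 * p + 1) \<and> plex_col m r = c mod (2 * m)}"
      using that by (auto simp: switched_plex_def col_def n' k image_iff)
    moreover have "inj (\<lambda>r. (r, c, cell m n r c))"
      by (rule injI) simp
    ultimately show ?thesis
      using card_plex_col[of "c mod (2 * m)" m p] assms(2) k
      by (simp add: card_image inj_on_subset)
  qed
  have symbs: "card {e \<in> ?P. symb e = s} = k" if "s < n" for s
  proof -
    \<comment> \<open>A symbol occurs once in each row, so its entries in the plex can be counted by
      their rows.\<close>
    have inj: "inj_on row {e \<in> ?P. symb e = s}"
      using cell_row_inj[OF mn(1)]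
      by (auto simp: inj_on_def switched_plex_def row_def symb_def)
    have img: "row ` {e \<in> ?P. symb e = s} = {r. r < n \<and> plex_symb m r = s mod (2 * m)}"
    proof (intro equalityI subsetI)
      fix r assume "r \<in> row ` {e \<in> ?P. symb e = s}"
      then show "r \<in> {r. r < n \<and> plex_symb m r = s mod (2 * m)}"
        using plex_col_iff_plex_symb[OF assms(2) mn(2)]
        by (auto simp: switched_plex_def row_def symb_def)
    next
      fix r assume "r \<in> {r. r < n \<and> plex_symb m r = s mod (2 * m)}"
      then have r: "r < n" "plex_symb m r = s mod (2 * m)"
        by simp_all
      have "\<exists>!c. c < n \<and> cell m n r c = s"
        using \<open>s < n\<close> by (intro inj_on_lessThan_ex1 cell_row_inj[OF mn(1)]) (simp_all add: cell_def)
      then obtain c where "c < n" "cell m n r c = s"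
        by blast
      then have "(r, c, s) \<in> {e \<in> ?P. symb e = s}"
        using plex_col_iff_plex_symb[OF assms(2) mn(2), of c r] r
        by (simp add: switched_plex_def symb_def)
      then show "r \<in> row ` {e \<in> ?P. symb e = s}"
        by (auto simp: row_def image_iff)
    qed
    show ?thesis
      using card_image[OF inj, unfolded img] card_plex_symb[of "s mod (2 * m)" m p] assms(2) k n' by simp
  qed
  have "row ` ?P \<subseteq> {..<n}"
    by (auto simp: switched_plex_def row_def)
  then have "card ?P = (\<Sum>r<n. card {e \<in> ?P. row e = r})"
    using sum.group[OF fin finite_lessThan, of row n "\<lambda>_. 1::nat"] by simp
  also have "\<dots> = k * n"
    using rows by simp
  finally show ?thesis
    using sub rows cols symbs by (simp add: plex_def)
qed

theorem theorem3p2: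
  fixes k m n :: nat
  assumes "odd k" and "m \<ge> 2" and "n = 2 * k * m"
  shows "\<exists>L. latin_square n L \<and>
           (\<exists>P. plex k n L P) \<and>
           (\<forall>k'. odd k' \<and> k' < k \<longrightarrow> \<not> (\<exists>P. plex k' n L P))"
proof -
  have "m dvd n" "m < n"
    using assms by (auto elim: oddE)
  then have "latin_square n (switched_square m n)"
    by (rule latin_switched_square)
  moreover have "plex k n (switched_square m n) (switched_plex m n)"
    using assms by (rule plex_switched_plex)
  moreover have "\<not> plex k' n (switched_square m n) P" if "odd k'" "k' < k" for k' P
    using no_small_odd_plex[OF assms(1) _ assms(3) that] assms(2) by simp
  ultimately show ?thesis
    by blast
qed

end
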